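(* Let $\Gamma$ be a bipartite $Q$-polynomial distance-regular graph with diameter $D=5$ and valency $k\ge3$. Then $c_2\ge2$. In particular, the girth of $\Gamma$ is $4$.
   Context: Graphs are finite, undirected, connected, simple. For a distance-regular graph, $c_i=p^i_{1,i-1}$ where $p^h_{ij}=|\Gamma_i(x)\cap\Gamma_j(y)|$ for $\partial(x,y)=h$ (independent of $x,y$). $Q$-polynomial: there is an ordering $E_0,\dots,E_D$ of the primitive idempotents of the Bose–Mesner algebra, with $E_0=|X|^{-1}J$, such that the Krein parameters defined by $E_i\circ E_j=|X|^{-1}\sum_h q^h_{ij}E_h$ satisfy, for distinct $i,j$, $q^1_{ij}\ne0$ iff $|i-j|=1$. *)

theory Defs
  imports "HOL-Analysis.Analysis" "HOL-Library.Extended_Nat"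
begin

text \<open>
  A graph is given by its adjacency relation \<open>E\<close>; the vertex set \<open>X\<close> is the universe of a finite
  type, so that matrices with rows and columns indexed by \<open>X\<close> have type \<open>real^'v^'v\<close>.
\<close>

definition simple_graph :: "'v::finite rel \<Rightarrow> bool" where
  "simple_graph E \<longleftrightarrow> sym E \<and> irrefl E"

definition connected_graph :: "'v::finite rel \<Rightarrow> bool" where
  "connected_graph E \<longleftrightarrow> (\<forall>x y. (x, y) \<in> E\<^sup>*)"

definition bipartite :: "'v::finite rel \<Rightarrow> bool" where
  "bipartite E \<longleftrightarrow> (\<exists>P Q. P \<union> Q = UNIV \<and> P \<inter> Q = {} \<and>
     (\<forall>(x, y) \<in> E. (x \<in> P \<and> y \<in> Q) \<or> (x \<in> Q \<and> y \<in> P)))"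

definition regular_graph :: "'v::finite rel \<Rightarrow> nat \<Rightarrow> bool" where
  "regular_graph E k \<longleftrightarrow> (\<forall>x. card (E `` {x}) = k)"

text \<open>\<open>(x, y) \<in> E ^^ n\<close> says that there is a walk of length \<open>n\<close> from \<open>x\<close> to \<open>y\<close>.  The distance is
  only meaningful for connected graphs.\<close>

definition gdist :: "'v::finite rel \<Rightarrow> 'v \<Rightarrow> 'v \<Rightarrow> nat" where
  "gdist E x y = (LEAST n. (x, y) \<in> E ^^ n)"

definition graph_diameter :: "'v::finite rel \<Rightarrow> nat" where
  "graph_diameter E = Max {gdist E x y | x y. True}"

definition sphere_at :: "'v::finite rel \<Rightarrow> nat \<Rightarrow> 'v \<Rightarrow> 'v set" where
  "sphere_at E i x = {z. gdist E x z = i}"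

text \<open>A cycle is the list of its vertices, without repetition of the first one at the end.\<close>

definition is_cycle :: "'v::finite rel \<Rightarrow> 'v list \<Rightarrow> bool" where
  "is_cycle E c \<longleftrightarrow> length c \<ge> 3 \<and> distinct c \<and>
     (\<forall>i < length c. (c ! i, c ! (Suc i mod length c)) \<in> E)"

text \<open>The girth of a forest is \<open>\<infinity>\<close>, the infimum of the empty set.\<close>

definition girth :: "'v::finite rel \<Rightarrow> enat" where
  "girth E = (INF c \<in> {c. is_cycle E c}. enat (length c))"

definition distance_regular :: "'v::finite rel \<Rightarrow> bool" where
  "distance_regular E \<longleftrightarrow> simple_graph E \<and> connected_graph E \<and>
     (\<forall>h i j. \<exists>p. \<forall>x y. gdist E x y = h \<longrightarrow> card (sphere_at E i x \<inter> sphere_at E j y) = p)"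

text \<open>\<open>p\<^sup>h\<^sub>i\<^sub>j\<close>, written \<open>intersection_number E h i j\<close>.  The description is unique when \<open>E\<close> is
  distance-regular and \<open>h\<close> does not exceed the diameter.\<close>

definition intersection_number :: "'v::finite rel \<Rightarrow> nat \<Rightarrow> nat \<Rightarrow> nat \<Rightarrow> nat" where
  "intersection_number E h i j =
     (THE p. \<forall>x y. gdist E x y = h \<longrightarrow> card (sphere_at E i x \<inter> sphere_at E j y) = p)"

lemma intersection_number_eq:
  assumes "distance_regular E"
  shows "intersection_number E (gdist E x y) i j = card (sphere_at E i x \<inter> sphere_at E j y)"
proof -
  obtain p where "\<forall>u v. gdist E u v = gdist E x y \<longrightarrow>
      card (sphere_at E i u \<inter> sphere_at E j v) = p"
    using assms unfolding distance_regular_def by meson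
  then show ?thesis
    unfolding intersection_number_def by (intro the_equality) auto
qed

text \<open>The number \<open>c\<^sub>i\<close>, for \<open>1 \<le> i\<close> and \<open>i\<close> at most the diameter.\<close>

definition c_number :: "'v::finite rel \<Rightarrow> nat \<Rightarrow> nat" where
  "c_number E i = intersection_number E i 1 (i - 1)"

definition distance_matrix :: "'v::finite rel \<Rightarrow> nat \<Rightarrow> real^'v^'v" where
  "distance_matrix E i = (\<chi> x y. if gdist E x y = i then 1 else 0)"

definition bose_mesner :: "'v::finite rel \<Rightarrow> (real^'v^'v) set" where
  "bose_mesner E = span (distance_matrix E ` {..graph_diameter E})"

definition primitive_idempotent :: "(real^'v^'v) set \<Rightarrow> real^'v::finite^'v \<Rightarrow> bool" where
  "primitive_idempotent M F \<longleftrightarrow> F \<in> M \<and> F \<noteq> 0 \<and> F ** F = F \<and>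
     (\<forall>G \<in> M. \<forall>H \<in> M. G ** G = G \<and> H ** H = H \<and> G ** H = 0 \<and> H ** G = 0 \<and> F = G + H
        \<longrightarrow> G = 0 \<or> H = 0)"

definition hadamard :: "real^'v^'v \<Rightarrow> real^'v^'v \<Rightarrow> real^'v::finite^'v" where
  "hadamard A B = (\<chi> x y. A $ x $ y * B $ x $ y)"

text \<open>\<open>q h i j\<close> stands for \<open>q\<^sup>h\<^sub>i\<^sub>j\<close>.  For \<open>h, i, j \<le> D\<close> the equation determines it, because primitive
  idempotents \<open>F 0, \<dots>, F D\<close> of a Bose-Mesner algebra are linearly independent.\<close>

definition krein_parameters :: "(nat \<Rightarrow> real^'v::finite^'v) \<Rightarrow> nat \<Rightarrow> (nat \<Rightarrow> nat \<Rightarrow> nat \<Rightarrow> real) \<Rightarrow> bool"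
  where "krein_parameters F D q \<longleftrightarrow> (\<forall>i \<le> D. \<forall>j \<le> D.
     hadamard (F i) (F j) = (1 / real CARD('v)) *\<^sub>R (\<Sum>h \<le> D. q h i j *\<^sub>R F h))"

text \<open>The matrix \<open>\<chi> x y. 1 / |X|\<close> is \<open>|X|\<^sup>-\<^sup>1 J\<close>.\<close>

definition Q_polynomial :: "'v::finite rel \<Rightarrow> bool" where
  "Q_polynomial E \<longleftrightarrow> (let D = graph_diameter E in
     \<exists>F q. bij_betw F {..D} {P. primitive_idempotent (bose_mesner E) P} \<and>
       F 0 = (\<chi> x y. 1 / real CARD('v)) \<and>
       krein_parameters F D q \<and>
       (\<forall>i \<le> D. \<forall>j \<le> D. i \<noteq> j \<longrightarrow> (q 1 i j \<noteq> 0 \<longleftrightarrow> \<bar>int i - int j\<bar> = 1)))"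

end

theory Submission
  imports Defs
begin

text \<open>
  Write the entries of \<open>F 1\<close> as \<open>\<tau>\<close> of the distance, and suppose \<open>c\<^sub>2 = 1\<close>.  The six primitive
  idempotents are orthogonal in an algebra of dimension at most six, hence a basis, so no spectral
  theorem is needed.  The vanishing Krein parameters give Terwilliger's balanced set condition, which
  for vertices \<open>x, y, z\<close> on a geodesic is a three-term recurrence for
  \<open>\<delta>\<^sub>i = \<tau> (i - 1) - \<tau> i\<close>.  Together with the eigenvalue equations it confines
  \<open>a = \<delta>\<^sub>2 / \<delta>\<^sub>3\<close> and \<open>w = (\<delta>\<^sub>2 + \<delta>\<^sub>4) / \<delta>\<^sub>3\<close> to a plane curve.  For the triples with
  distances \<open>2, 3, 3\<close> the same condition, applied to two kinds of such triples, shows that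
  \<open>g = (\<delta>\<^sub>2 + \<delta>\<^sub>3) / (\<delta>\<^sub>3 + \<delta>\<^sub>4)\<close> is an integer.  In terms of \<open>g\<close> the curve becomes a quadratic
  equation for \<open>(g + 1) a\<close>, a rational number, with discriminant \<open>(g\<^sup>2 - g + 1)\<^sup>2 + 4 g\<close>.  That lies strictly
  between two consecutive squares of its parity unless \<open>g = 0\<close>, which is impossible because the
  values \<open>\<tau> 0, \<dots>, \<tau> 5\<close> are distinct.
\<close>

section \<open>A curve without integral points\<close>

text \<open>Both \<open>g\<^sup>2 - g + 1\<close> and \<open>\<bar>t\<bar>\<close> would be odd, so,
  being different, they differ by at least 2. Then their squares differ by more than
  \<open>4 * \<bar>g\<bar>\<close>.\<close>

lemma shifted_square_not_square:
  fixes g t :: int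
  assumes "g \<noteq> 0"
  shows "t\<^sup>2 \<noteq> (g\<^sup>2 - g + 1)\<^sup>2 + 4 * g"
proof
  assume eq: "t\<^sup>2 = (g\<^sup>2 - g + 1)\<^sup>2 + 4 * g"
  define u where "u = g\<^sup>2 - g + 1"
  define v where "v = \<bar>t\<bar>"
  have eq': "v\<^sup>2 = u\<^sup>2 + 4 * g"
    using eq by (simp add: u_def v_def)
  have "even (g\<^sup>2 - g)" by simp
  then have "odd u" unfolding u_def by simp
  moreover have "even (v\<^sup>2) = even (u\<^sup>2)" using eq' by simp
  ultimately have "odd v" by simp
  have "u > 0"
    using zero_le_power2[of "2 * g - 1"] by (simp add: u_def power2_eq_square algebra_simps)
  have "v \<ge> 0" by (simp add: v_def)
  have sq: "u = g * g - g + 1" by (simp add: u_def power2_eq_square)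
  show False
  proof (cases "g > 0")
    case True
    have "v > u"
      using eq' True \<open>v \<ge> 0\<close> by (intro power2_less_imp_less[of u v]) auto
    then have "v \<ge> u + 2" using \<open>odd u\<close> \<open>odd v\<close> by presburger
    then have "(u + 2)\<^sup>2 \<le> v\<^sup>2" using \<open>u > 0\<close> by (intro power_mono) auto
    moreover have "(u + 2)\<^sup>2 = u\<^sup>2 + 4 * u + 4" by algebra
    ultimately have "4 * u + 4 \<le> 4 * g" using eq' by linarith
    then show False
      using sq zero_le_square[of "g - 1"] by (simp add: algebra_simps)
  next
    case False
    then have "g < 0" using assms by simp
    have "v < u"
      using eq' \<open>g < 0\<close> \<open>u > 0\<close> by (intro power2_less_imp_less[of v u]) auto
    then have "v \<le> u - 2" using \<open>odd u\<close> \<open>odd v\<close> by presburger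
    then have "v\<^sup>2 \<le> (u - 2)\<^sup>2" using \<open>v \<ge> 0\<close> by (intro power_mono) auto
    moreover have "(u - 2)\<^sup>2 = u\<^sup>2 - 4 * u + 4" by algebra
    ultimately have "4 * g \<le> 4 - 4 * u" using eq' by linarith
    then show False
      using sq \<open>g < 0\<close> mult_neg_neg[of g g] by (simp add: algebra_simps)
  qed
qed

text \<open>The same for a rational number \<open>s / N\<close>, since
  \<open>N\<^sup>2 dvd s\<^sup>2\<close> forces \<open>N dvd s\<close>. This absorbs the denominator
  of a rational root of the quadratic equation.\<close>

lemma scaled_shifted_square_not_square:
  fixes g s N :: int
  assumes "g \<noteq> 0" "N \<noteq> 0"
  shows "s\<^sup>2 \<noteq> N\<^sup>2 * ((g\<^sup>2 - g + 1)\<^sup>2 + 4 * g)"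
proof
  assume eq: "s\<^sup>2 = N\<^sup>2 * ((g\<^sup>2 - g + 1)\<^sup>2 + 4 * g)"
  then have "N\<^sup>2 dvd s\<^sup>2" by simp
  then have "N dvd s" by simp
  then obtain t where "s = N * t" ..
  with eq have "t\<^sup>2 = (g\<^sup>2 - g + 1)\<^sup>2 + 4 * g"
    using \<open>N \<noteq> 0\<close> by (simp add: power_mult_distrib)
  with shifted_square_not_square[OF \<open>g \<noteq> 0\<close>] show False by blast
qed

text \<open>Here \<open>d1\<close>, \<open>a\<close>, 1, \<open>b\<close>, \<open>d5\<close> stand
  for the five differences \<open>\<delta>\<^sub>1\<close> to \<open>\<delta>\<^sub>5\<close>
  divided by \<open>\<delta>\<^sub>3\<close>, and \<open>K\<close> for \<open>k - 1\<close>. The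
  hypotheses \<open>e0\<close> to \<open>e4\<close> are differences of consecutive eigenvalue
  equations. Eliminating \<open>K\<close>, \<open>\<theta>\<close>, \<open>c3\<close> and
  \<open>c4\<close> leaves one relation between \<open>a\<close> and \<open>w\<close>.\<close>

lemma dual_ratio_curve:
  fixes a b w K \<theta> c3 c4 d1 d5 :: real
  assumes "a \<noteq> 0" and w: "w = a + b" and d1: "d1 = w * a - 1" and d5: "d5 = w * b - 1"
    and e0: "K * a = (\<theta> + 1) * d1"
    and e1: "d1 + K = \<theta> * a"
    and e2: "a + (1 - c3) + (K + 1 - c3) * b = \<theta>"
    and e3: "c3 + (c3 - c4) * b + (K + 1 - c4) * d5 = \<theta> * b"
    and e4: "c4 * b + (c4 - (K + 1)) * d5 = \<theta> * d5"
  shows "(w\<^sup>2 + 3 * w + 1) * (a\<^sup>2 + 1) = (w ^ 3 + 3 * w\<^sup>2 + 2 * w + 2) * a"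
proof -
  have K: "K * (1 - a * b) = (w * a + a - 1) * (w * a - 1)"
    using e0 e1 unfolding d1 w by algebra
  have "a * (\<theta> * (1 - a * b)) = a * ((a + 1) * (w * a - 1))"
    using K e1 unfolding d1 w by algebra
  then have \<theta>: "\<theta> * (1 - a * b) = (a + 1) * (w * a - 1)"
    using \<open>a \<noteq> 0\<close> by simp
  have "a * (c3 * (1 + b)) = a * ((w + 1) * (2 - w * a))"
    using K e1 e2 unfolding d1 w by algebra
  then have c3: "c3 * (1 + b) = (w + 1) * (2 - w * a)"
    using \<open>a \<noteq> 0\<close> by simp
  \<comment> \<open>Adding \<open>e3\<close> and \<open>e4\<close> cancels both \<open>c4\<close>
    and \<open>K\<close>, which gives a second expression for \<open>c3 * (1 + b)\<close>.\<close>
  have "c3 * (1 + b) = \<theta> * (b + d5)"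
    using e3 e4 by algebra
  then have "(w + 1) * (2 - w * a) * (1 - a * b) = (a + 1) * (w * a - 1) * (b + d5)"
    using c3 \<theta> by algebra
  then show ?thesis unfolding d5 w by algebra
qed

text \<open>Once \<open>b\<close> is expressed through \<open>a\<close> and \<open>g\<close>, the
  equation of the curve has degree four in \<open>a\<close> and contains the factor
  \<open>(a + 1)\<^sup>2\<close>. Cancelling it leaves a quadratic.\<close>

lemma dual_ratio_curve_by_g:
  fixes a b w g :: real
  assumes "a + 1 \<noteq> 0" "1 + b \<noteq> 0" and w: "w = a + b" and g: "a + 1 = g * (1 + b)"
    and curve: "(w\<^sup>2 + 3 * w + 1) * (a\<^sup>2 + 1) = (w ^ 3 + 3 * w\<^sup>2 + 2 * w + 2) * a"
  shows "((g + 1) * a)\<^sup>2 - (g\<^sup>2 + g - 1) * ((g + 1) * a) + g * (g\<^sup>2 - g - 1) = 0"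
proof -
  have "g * w = (g + 1) * a + 1 - g"
    using g w by algebra
  then have "(a + 1)\<^sup>2 * (((g + 1) * a)\<^sup>2 - (g\<^sup>2 + g - 1) * ((g + 1) * a) + g * (g\<^sup>2 - g - 1)) = 0"
    using curve by algebra
  then show ?thesis using assms(1) by simp
qed

text \<open>In the application \<open>c\<close> is the intersection number \<open>c 3\<close>, and
  \<open>f0\<close>, \<open>f1\<close> count vertices for two kinds of triples. The difference of
  these counts is \<open>g\<close>, hence an integer, and \<open>\<alpha>\<close> is a fraction with
  denominator \<open>f0\<close>. The discriminant of its quadratic equation would then be a rational
  square.\<close>

lemma dual_ratio_not_integral:
  fixes a b w r :: real and c f0 f1 :: int
  assumes "a + 1 \<noteq> 0" "1 + b \<noteq> 0" and w: "w = a + b"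
    and curve: "(w\<^sup>2 + 3 * w + 1) * (a\<^sup>2 + 1) = (w ^ 3 + 3 * w\<^sup>2 + 2 * w + 2) * a"
    and c: "of_int c = r * (w + 1)" and "c \<noteq> 0"
    and f0: "of_int f0 * (1 + b) = r * (w + 2)"
    and f1: "(a + 1) + of_int f1 * (1 + b) = r * (w + 2)"
  shows False
proof -
  define g where "g = f0 - f1"
  define \<gamma> where "\<gamma> = real_of_int g"
  define \<alpha> where "\<alpha> = (\<gamma> + 1) * a"
  have g: "a + 1 = \<gamma> * (1 + b)"
    using f0 f1 unfolding g_def \<gamma>_def by (simp add: algebra_simps)
  have "g \<noteq> 0" using g assms(1) by (auto simp: \<gamma>_def)
  have quad: "\<alpha>\<^sup>2 - (\<gamma>\<^sup>2 + \<gamma> - 1) * \<alpha> + \<gamma> * (\<gamma>\<^sup>2 - \<gamma> - 1) = 0"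
    unfolding \<alpha>_def using dual_ratio_curve_by_g[OF assms(1,2) w g curve] .
  \<comment> \<open>This is what makes \<open>f0\<close> nonzero, since
    \<open>f0 = r * (1 + \<gamma>)\<close>. At \<open>w = -2\<close> the only point of the curve is
    the excluded \<open>a = -1\<close>.\<close>
  have "\<gamma> \<noteq> -1"
  proof
    assume "\<gamma> = -1"
    then have "w = -2" using g w by simp
    with curve have "(a + 1)\<^sup>2 = 0" by (simp add: power2_eq_square algebra_simps)
    then show False using assms(1) by simp
  qed
  have "(1 + b) * of_int f0 = (1 + b) * (r * (1 + \<gamma>))"
    using f0 g w by algebra
  then have f0': "of_int f0 = r * (1 + \<gamma>)" using assms(2) by simp
  have "r \<noteq> 0" using c \<open>c \<noteq> 0\<close> by auto
  then have "f0 \<noteq> 0" using f0' \<open>\<gamma> \<noteq> -1\<close> by auto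
  have "\<gamma> * (w + 1) = \<alpha> + 1"
    unfolding \<alpha>_def using g w by algebra
  then have \<alpha>: "of_int f0 * \<alpha> = of_int c * \<gamma> * (1 + \<gamma>) - of_int f0"
    using f0' c by algebra
  \<comment> \<open>\<open>s / f0\<close> is a square root of the discriminant: twice the root
    \<open>\<alpha>\<close> minus the sum of both roots.\<close>
  define s where "s = 2 * (c * g * (1 + g) - f0) - f0 * (g\<^sup>2 + g - 1)"
  have s: "real_of_int s = of_int f0 * (2 * \<alpha> - (\<gamma>\<^sup>2 + \<gamma> - 1))"
    unfolding s_def using \<alpha> by (simp add: \<gamma>_def algebra_simps)
  have "(real_of_int s)\<^sup>2 = (of_int f0)\<^sup>2 * ((\<gamma>\<^sup>2 - \<gamma> + 1)\<^sup>2 + 4 * \<gamma>)"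
    using s quad by algebra
  then have "real_of_int (s\<^sup>2) = of_int (f0\<^sup>2 * ((g\<^sup>2 - g + 1)\<^sup>2 + 4 * g))"
    by (simp add: \<gamma>_def)
  then have "s\<^sup>2 = f0\<^sup>2 * ((g\<^sup>2 - g + 1)\<^sup>2 + 4 * g)" by (simp only: of_int_eq_iff)
  then show False
    using scaled_shifted_square_not_square[OF \<open>g \<noteq> 0\<close> \<open>f0 \<noteq> 0\<close>] by blast
qed

text \<open>Serves to exclude \<open>c 4 = 1\<close>. In that case \<open>c 3 = 1\<close> too, and
  \<open>e2\<close> simplifies to the form used here. The conclusion \<open>a = -1\<close> would
  mean \<open>\<tau> 1 = \<tau> 3\<close>.\<close>

lemma unit_dual_ratio:
  fixes a b w K \<theta> d1 :: real
  assumes w: "w = a + b" and d1: "d1 = w * a - 1" and "K \<noteq> 1" "a \<noteq> 0"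
    and e0: "K * a = (\<theta> + 1) * d1"
    and e1: "d1 + K = \<theta> * a"
    and e2: "a + K * b = \<theta>"
  shows "a = -1"
proof -
  have "(K - 1) * (a * b - 1) = 0"
    using e1 e2 unfolding d1 w by algebra
  then have ab: "a * b = 1" using \<open>K \<noteq> 1\<close> by simp
  then have "d1 = a\<^sup>2" unfolding d1 w by algebra
  then have "a * (a * (a + 1)) = 0"
    using e0 e1 e2 ab by algebra
  then show ?thesis using \<open>a \<noteq> 0\<close> by simp
qed

section \<open>Distance-regular graphs and the Bose-Mesner algebra\<close>

lemma linear_matrix_mult_left: "linear (\<lambda>A. A ** B)" for B :: "real^'n^'m"
  by (intro linearI) (simp_all add: vec_eq_iff matrix_matrix_mult_def sum.distrib sum_distrib_left algebra_simps)

lemma linear_matrix_mult_right: "linear (\<lambda>A. B ** A)" for B :: "real^'n^'m"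
  by (intro linearI) (simp_all add: matrix_add_ldistrib matrix_scalar_ac scalar_matrix_assoc)

lemmas matrix_mult_linear_simps =
  linear_diff[OF linear_matrix_mult_left] linear_diff[OF linear_matrix_mult_right]
  linear_cmul[OF linear_matrix_mult_left] linear_cmul[OF linear_matrix_mult_right]
  linear_sum[OF linear_matrix_mult_left] linear_sum[OF linear_matrix_mult_right]

locale distance_regular_graph =
  fixes E :: "'v::finite rel"
  assumes distance_regular: "distance_regular E"
begin

abbreviation d :: "'v \<Rightarrow> 'v \<Rightarrow> nat" where "d \<equiv> gdist E"
abbreviation S :: "nat \<Rightarrow> 'v \<Rightarrow> 'v set" where "S \<equiv> sphere_at E"
abbreviation D :: nat where "D \<equiv> graph_diameter E"
abbreviation p :: "nat \<Rightarrow> nat \<Rightarrow> nat \<Rightarrow> nat" where "p \<equiv> intersection_number E"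

section \<open>Distances, geodesics and the diameter\<close>

lemma sym_E: "sym E" and irrefl_E: "irrefl E" and connected: "connected_graph E"
  using distance_regular by (auto simp: distance_regular_def simple_graph_def)

lemma mem_S [simp]: "z \<in> S i x \<longleftrightarrow> d x z = i"
  by (simp add: sphere_at_def)

lemma card_S_Int_S: "d x y = h \<Longrightarrow> card (S i x \<inter> S j y) = p h i j"
  using intersection_number_eq[OF distance_regular] by metis

lemma gdist_le: "(x, y) \<in> E ^^ n \<Longrightarrow> d x y \<le> n"
  unfolding gdist_def by (rule Least_le)

lemma gdist_walk: "(x, y) \<in> E ^^ d x y"
proof -
  have "(x, y) \<in> E\<^sup>*" using connected by (simp add: connected_graph_def)
  then obtain n where "(x, y) \<in> E ^^ n" by (auto simp: rtrancl_power)
  then show ?thesis unfolding gdist_def by (rule LeastI)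
qed

lemma gdist_triangle: "d x z \<le> d x y + d y z"
  by (intro gdist_le) (use gdist_walk[of x y] gdist_walk[of y z] in \<open>auto simp: relpow_add\<close>)

lemma gdist_sym: "d x y = d y x"
proof -
  have "(y, x) \<in> E ^^ n" if "(x, y) \<in> E ^^ n" for x y n
    using that
  proof (induction n arbitrary: y)
    case (Suc n)
    then obtain z where "(x, z) \<in> E ^^ n" "(z, y) \<in> E" by auto
    then show ?case
      using Suc.IH sym_E by (metis relpow_Suc_I2 symE)
  qed auto
  then show ?thesis using gdist_le gdist_walk by (meson le_antisym)
qed

lemma gdist_eq_0 [simp]: "d x y = 0 \<longleftrightarrow> x = y"
  using gdist_walk[of x y] gdist_le[of x y 0] by fastforce

lemma gdist_eq_1: "d x y = 1 \<longleftrightarrow> (x, y) \<in> E"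
proof
  show "d x y = 1 \<Longrightarrow> (x, y) \<in> E" using gdist_walk[of x y] by simp
  assume xy: "(x, y) \<in> E"
  then have "x \<noteq> y" using irrefl_E by (auto simp: irrefl_def)
  then show "d x y = 1" using gdist_le[of x y 1] xy gdist_eq_0[of x y]
    by (simp add: le_Suc_eq)
qed

lemma gdist_eq_Suc_0 [simp]: "d x y = Suc 0 \<longleftrightarrow> (x, y) \<in> E"
  using gdist_eq_1 by simp

lemma gdist_edge: "d y z = 1 \<Longrightarrow> d x z \<le> d x y + 1 \<and> d x y \<le> d x z + 1"
  using gdist_triangle[of x z y] gdist_triangle[of x y z] gdist_sym[of y z] by linarith

lemma geodesic:
  assumes "d x z = m + n"
  obtains y where "d x y = m" "d y z = n"
proof -
  have "(x, z) \<in> E ^^ (m + n)" using gdist_walk[of x z] assms by simp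
  then obtain y where "(x, y) \<in> E ^^ m" "(y, z) \<in> E ^^ n" by (auto simp: relpow_add)
  then have "d x y \<le> m" "d y z \<le> n" by (auto intro: gdist_le)
  then have "d x y = m" "d y z = n" using gdist_triangle[of x z y] assms by auto
  then show ?thesis by (rule that)
qed

lemma finite_gdists: "finite {d x y | x y. True}"
  by (rule finite_subset[of _ "case_prod d ` UNIV"]) force+

lemma gdist_le_diameter: "d x y \<le> D"
  unfolding graph_diameter_def by (rule Max_ge[OF finite_gdists]) blast

lemma gdist_attained:
  assumes "i \<le> D"
  obtains x y where "d x y = i"
proof -
  have "D \<in> {d x y | x y. True}"
    unfolding graph_diameter_def by (rule Max_in[OF finite_gdists]) blast
  then obtain x z where "d x z = i + (D - i)" using assms by auto
  then obtain y where "d x y = i" by (rule geodesic)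
  with that show ?thesis by blast
qed

section \<open>The Bose-Mesner algebra as the matrices whose entries depend only on the
  distance\<close>

definition dmat :: "(nat \<Rightarrow> real) \<Rightarrow> real^'v^'v" where
  "dmat f = (\<chi> x y. f (d x y))"

lemma dmat_nth [simp]: "dmat f $ x $ y = f (d x y)"
  by (simp add: dmat_def)

lemma dmat_eq_sum: "dmat f = (\<Sum>h\<le>D. f h *\<^sub>R distance_matrix E h)"
  by (simp add: vec_eq_iff distance_matrix_def if_distrib[of "\<lambda>t. _ * t"] gdist_le_diameter
      cong: if_cong)

lemma bose_mesner_eq: "bose_mesner E = range dmat"
proof
  have "subspace (range dmat)"
  proof (rule subspaceI)
    show "0 \<in> range dmat" by (rule range_eqI[of _ _ "\<lambda>_. 0"]) (simp add: vec_eq_iff)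
    show "F + G \<in> range dmat" if "F \<in> range dmat" "G \<in> range dmat" for F G
    proof -
      obtain f g where "F = dmat f" "G = dmat g" using \<open>F \<in> range dmat\<close> \<open>G \<in> range dmat\<close> by blast
      then show ?thesis by (intro range_eqI[of _ _ "\<lambda>h. f h + g h"]) (simp add: vec_eq_iff)
    qed
    show "c *\<^sub>R F \<in> range dmat" if "F \<in> range dmat" for c F
    proof -
      obtain f where "F = dmat f" using \<open>F \<in> range dmat\<close> by blast
      then show ?thesis by (intro range_eqI[of _ _ "\<lambda>h. c * f h"]) (simp add: vec_eq_iff)
    qed
  qed
  moreover have "distance_matrix E i \<in> range dmat" for i
    by (rule range_eqI[of _ _ "\<lambda>h. if h = i then 1 else 0"])
      (simp add: vec_eq_iff distance_matrix_def)
  ultimately show "bose_mesner E \<subseteq> range dmat"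
    unfolding bose_mesner_def by (intro span_minimal) auto
  show "range dmat \<subseteq> bose_mesner E"
    unfolding bose_mesner_def dmat_eq_sum
    by (intro image_subsetI span_sum span_scale span_base imageI)
qed

text \<open>The vertices \<open>z\<close> summed over in the matrix product are sorted by their
  distances \<open>i\<close> from \<open>x\<close> and \<open>j\<close> from
  \<open>y\<close>.\<close>

lemma dmat_mult: "dmat f ** dmat g = dmat (\<lambda>h. \<Sum>i\<le>D. \<Sum>j\<le>D. f i * g j * real (p h i j))"
proof -
  have "(\<Sum>z\<in>UNIV. f (d x z) * g (d z y)) =
      (\<Sum>i\<le>D. \<Sum>j\<le>D. f i * g j * real (p (d x y) i j))" for x y
  proof -
    have "(\<Sum>z\<in>UNIV. f (d x z) * g (d z y)) =
        (\<Sum>z\<in>UNIV. \<Sum>i\<le>D. \<Sum>j\<le>D. if z \<in> S i x \<inter> S j y then f i * g j else 0)"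
    proof (rule sum.cong)
      fix z
      have "(\<Sum>i\<le>D. \<Sum>j\<le>D. if z \<in> S i x \<inter> S j y then f i * g j else 0) =
          (\<Sum>i\<le>D. if i = d x z then \<Sum>j\<le>D. if j = d y z then f i * g j else 0 else 0)"
        by (intro sum.cong) auto
      then show "f (d x z) * g (d z y) =
          (\<Sum>i\<le>D. \<Sum>j\<le>D. if z \<in> S i x \<inter> S j y then f i * g j else 0)"
        by (simp add: gdist_le_diameter gdist_sym[of z y])
    qed simp
    also have "\<dots> = (\<Sum>i\<le>D. \<Sum>j\<le>D. \<Sum>z\<in>UNIV. if z \<in> S i x \<inter> S j y then f i * g j else 0)"
      by (subst sum.swap, subst (2) sum.swap) simp
    also have "\<dots> = (\<Sum>i\<le>D. \<Sum>j\<le>D. f i * g j * real (p (d x y) i j))"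
      by (simp add: sum.If_cases card_S_Int_S[OF refl, symmetric] Collect_conj_eq sphere_at_def
          mult.commute)
    finally show ?thesis .
  qed
  then show ?thesis by (simp add: vec_eq_iff matrix_matrix_mult_def)
qed

text \<open>The product is again some \<open>dmat\<close>, hence symmetric, and symmetric matrices
  with a symmetric product commute.\<close>

lemma dmat_mult_commute: "dmat f ** dmat g = dmat g ** dmat f"
proof -
  have tr: "transpose (dmat h) = dmat h" for h
    by (simp add: vec_eq_iff transpose_def gdist_sym)
  have "dmat f ** dmat g = transpose (dmat f ** dmat g)"
    by (simp only: dmat_mult tr)
  also have "\<dots> = dmat g ** dmat f"
    by (simp only: matrix_transpose_mul tr)
  finally show ?thesis .
qed

lemma mat_1_eq_dmat: "mat 1 = dmat (\<lambda>h. if h = 0 then 1 else 0)"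
  by (simp add: vec_eq_iff mat_def)

lemma bose_mesner_mult: "G \<in> bose_mesner E \<Longrightarrow> H \<in> bose_mesner E \<Longrightarrow> G ** H \<in> bose_mesner E"
  and bose_mesner_commute: "G \<in> bose_mesner E \<Longrightarrow> H \<in> bose_mesner E \<Longrightarrow> G ** H = H ** G"
  unfolding bose_mesner_eq using dmat_mult dmat_mult_commute by auto

lemma subspace_bose_mesner: "subspace (bose_mesner E)"
  by (simp add: bose_mesner_def)

lemma dim_bose_mesner: "dim (bose_mesner E) \<le> Suc D"
proof -
  have "dim (bose_mesner E) \<le> card (distance_matrix E ` {..D})"
    unfolding bose_mesner_def by (intro dim_le_card) auto
  also have "\<dots> \<le> Suc D" using card_image_le[of "{..D}"] by simp
  finally show ?thesis .
qed

text \<open>\<open>F\<close> splits into the orthogonal idempotents \<open>F ** G\<close> and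
  \<open>F - F ** G\<close>, so primitivity leaves \<open>F ** G = 0\<close> or
  \<open>F ** G = F\<close>. Exchanging the roles, \<open>F ** G\<close> is also 0 or
  \<open>G\<close>.\<close>

lemma primitive_idempotents_orthogonal:
  assumes F: "primitive_idempotent (bose_mesner E) F"
    and G: "primitive_idempotent (bose_mesner E) G" and "F \<noteq> G"
  shows "F ** G = 0"
proof -
  have absorb: "F ** G = 0 \<or> F ** G = F"
    if F: "primitive_idempotent (bose_mesner E) F" and G: "primitive_idempotent (bose_mesner E) G"
    for F G
  proof -
    have M: "F \<in> bose_mesner E" "G \<in> bose_mesner E" and FF: "F ** F = F" and GG: "G ** G = G"
      using F G by (auto simp: primitive_idempotent_def)
    have FG: "F ** G \<in> bose_mesner E" and GF: "G ** F = F ** G"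
      using M bose_mesner_mult bose_mesner_commute by auto
    have FGF: "F ** G ** F = F ** G"
      by (metis FF GF matrix_mul_assoc)
    have FFG: "F ** (F ** G) = F ** G"
      by (metis FF matrix_mul_assoc)
    have FGFG: "F ** G ** (F ** G) = F ** G"
      by (metis FGF GG matrix_mul_assoc)
    have "F - F ** G \<in> bose_mesner E"
      using M FG subspace_bose_mesner by (simp add: subspace_diff)
    moreover have "(F - F ** G) ** (F - F ** G) = F - F ** G"
      by (simp add: matrix_mult_linear_simps FF FGF FFG FGFG)
    moreover have "F ** G ** (F - F ** G) = 0" "(F - F ** G) ** (F ** G) = 0"
      by (simp_all add: matrix_mult_linear_simps FGF FFG FGFG)
    moreover have "F = F ** G + (F - F ** G)" by simp
    ultimately have "F ** G = 0 \<or> F - F ** G = 0"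
      using F FG FGFG unfolding primitive_idempotent_def by blast
    then show ?thesis by auto
  qed
  have "F ** G = G ** F"
    using F G by (intro bose_mesner_commute) (auto simp: primitive_idempotent_def)
  then show ?thesis using absorb[OF F G] absorb[OF G F] \<open>F \<noteq> G\<close> by metis
qed

end

section \<open>The balanced set condition\<close>

lemma inner_matrix: "inner A B = (\<Sum>x\<in>UNIV. \<Sum>y\<in>UNIV. A $ x $ y * B $ x $ y)" for A B :: "real^'n^'m"
  by (simp add: inner_vec_def)

lemma inner_hadamard_swap: "inner (hadamard A B) C = inner (hadamard B C) A"
  by (simp add: inner_matrix hadamard_def mult_ac)

locale Q_polynomial_graph = distance_regular_graph E for E :: "'v::finite rel" +
  fixes F :: "nat \<Rightarrow> real^'v^'v" and q :: "nat \<Rightarrow> nat \<Rightarrow> nat \<Rightarrow> real"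
  assumes bij_F: "bij_betw F {..D} {P. primitive_idempotent (bose_mesner E) P}"
    and F_0: "F 0 = (\<chi> x y. 1 / real CARD('v))"
    and krein: "krein_parameters F D q"
    and q_1: "\<And>i j. i \<le> D \<Longrightarrow> j \<le> D \<Longrightarrow> i \<noteq> j \<Longrightarrow> q 1 i j \<noteq> 0 \<longleftrightarrow> \<bar>int i - int j\<bar> = 1"
    and D_pos: "1 \<le> D"
begin

section \<open>The primitive idempotents as an orthogonal basis\<close>

lemma F_primitive: "i \<le> D \<Longrightarrow> primitive_idempotent (bose_mesner E) (F i)"
  using bij_F by (auto simp: bij_betw_def)

lemma F_in: "i \<le> D \<Longrightarrow> F i \<in> bose_mesner E"
  and F_nonzero: "i \<le> D \<Longrightarrow> F i \<noteq> 0"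
  and F_idem: "i \<le> D \<Longrightarrow> F i ** F i = F i"
  using F_primitive by (auto simp: primitive_idempotent_def)

lemma F_orthogonal: "i \<le> D \<Longrightarrow> j \<le> D \<Longrightarrow> i \<noteq> j \<Longrightarrow> F i ** F j = 0"
  using bij_F by (intro primitive_idempotents_orthogonal F_primitive) (auto simp: bij_betw_def inj_on_def)

lemma F_mult: "i \<le> D \<Longrightarrow> j \<le> D \<Longrightarrow> F i ** F j = (if i = j then F i else 0)"
  using F_orthogonal F_idem by simp

text \<open>\<open>F i\<close> determines \<open>f\<close> only at distances up to \<open>D\<close>,
  so a choice is made; the values beyond \<open>D\<close> are arbitrary.\<close>

definition dist_coeff :: "nat \<Rightarrow> nat \<Rightarrow> real" where
  "dist_coeff i = (SOME f. F i = dmat f)"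

abbreviation \<tau> :: "nat \<Rightarrow> real" where "\<tau> \<equiv> dist_coeff 1"

lemma F_eq_dmat: "i \<le> D \<Longrightarrow> F i = dmat (dist_coeff i)"
proof -
  assume "i \<le> D"
  then obtain f where "F i = dmat f" using F_in[of i] by (auto simp: bose_mesner_eq)
  then show ?thesis unfolding dist_coeff_def by (rule someI[of "\<lambda>f. F i = dmat f"])
qed

lemma F_nth [simp]: "i \<le> D \<Longrightarrow> F i $ x $ y = dist_coeff i (d x y)"
  by (simp add: F_eq_dmat)

text \<open>The matrices are symmetric, so their entrywise inner product is the trace of their
  matrix product.\<close>

lemma inner_F: "i \<le> D \<Longrightarrow> j \<le> D \<Longrightarrow> i \<noteq> j \<Longrightarrow> inner (F i) (F j) = 0"
proof -
  assume ij: "i \<le> D" "j \<le> D" "i \<noteq> j"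
  have "inner (F i) (F j) = (\<Sum>x\<in>UNIV. (F i ** F j) $ x $ x)"
    using ij by (simp add: inner_matrix matrix_matrix_mult_def gdist_sym)
  then show ?thesis using F_orthogonal[OF ij] by simp
qed

lemma bose_mesner_expansion:
  assumes "G \<in> bose_mesner E"
  obtains g where "G = (\<Sum>i\<le>D. g i *\<^sub>R F i)"
proof -
  have inj: "inj_on F {..D}" using bij_F by (simp add: bij_betw_def)
  have "independent (F ` {..D})"
  proof (rule pairwise_orthogonal_independent)
    show "pairwise orthogonal (F ` {..D})"
      using inner_F by (auto simp: pairwise_def orthogonal_def)
    show "0 \<notin> F ` {..D}" using F_nonzero by (metis atMost_iff imageE)
  qed
  moreover have "dim (bose_mesner E) \<le> card (F ` {..D})"
    using dim_bose_mesner inj by (simp add: card_image)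
  ultimately have "bose_mesner E \<subseteq> span (F ` {..D})"
    using F_in by (intro card_ge_dim_independent) auto
  then obtain u where "G = (\<Sum>P\<in>F ` {..D}. u P *\<^sub>R P)"
    using assms by (auto simp: span_finite)
  then have "G = (\<Sum>i\<le>D. u (F i) *\<^sub>R F i)"
    using inj by (simp add: sum.reindex)
  then show ?thesis by (rule that)
qed

lemma combination_mult_F:
  assumes "j \<le> D"
  shows "(\<Sum>i\<le>D. g i *\<^sub>R F i) ** F j = g j *\<^sub>R F j" "F j ** (\<Sum>i\<le>D. g i *\<^sub>R F i) = g j *\<^sub>R F j"
proof -
  have "(\<Sum>i\<le>D. g i *\<^sub>R (F i ** F j)) = (\<Sum>i\<le>D. if i = j then g j *\<^sub>R F j else 0)"
    by (intro sum.cong refl) (simp add: F_mult assms)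
  moreover have "(\<Sum>i\<le>D. g i *\<^sub>R (F j ** F i)) = (\<Sum>i\<le>D. if i = j then g j *\<^sub>R F j else 0)"
    by (intro sum.cong refl) (simp add: F_mult assms)
  ultimately show "(\<Sum>i\<le>D. g i *\<^sub>R F i) ** F j = g j *\<^sub>R F j"
    "F j ** (\<Sum>i\<le>D. g i *\<^sub>R F i) = g j *\<^sub>R F j"
    using assms by (simp_all add: matrix_mult_linear_simps)
qed

lemma eigenvalues:
  assumes "G \<in> bose_mesner E"
  obtains g where "\<And>i. i \<le> D \<Longrightarrow> G ** F i = g i *\<^sub>R F i" "\<And>i. i \<le> D \<Longrightarrow> F i ** G = g i *\<^sub>R F i"
proof -
  obtain g where "G = (\<Sum>i\<le>D. g i *\<^sub>R F i)" using bose_mesner_expansion[OF assms] .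
  then show ?thesis using that[of g] combination_mult_F by simp
qed

lemma sum_F: "(\<Sum>i\<le>D. F i) = mat 1"
proof -
  have "mat 1 \<in> bose_mesner E" by (simp add: bose_mesner_eq mat_1_eq_dmat)
  then obtain g where g: "mat 1 = (\<Sum>i\<le>D. g i *\<^sub>R F i)" by (rule bose_mesner_expansion)
  have "g j = 1" if "j \<le> D" for j
  proof -
    have "F j = g j *\<^sub>R F j"
      using combination_mult_F(1)[OF that, of g] unfolding g[symmetric] by simp
    then have "(1 - g j) *\<^sub>R F j = 0" by (simp add: scaleR_diff_left)
    then show ?thesis using F_nonzero[OF that] by simp
  qed
  then show ?thesis using g by simp
qed

section \<open>Krein parameters and the distinctness of the dual eigenvalues\<close>

lemma hadamard_F:
  "i \<le> D \<Longrightarrow> j \<le> D \<Longrightarrow> hadamard (F i) (F j) = (1 / real CARD('v)) *\<^sub>R (\<Sum>h\<le>D. q h i j *\<^sub>R F h)"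
  using krein by (simp add: krein_parameters_def)

lemma inner_hadamard_F:
  assumes "i \<le> D" "j \<le> D" "h \<le> D"
  shows "inner (hadamard (F i) (F j)) (F h) = q h i j * inner (F h) (F h) / real CARD('v)"
proof -
  have "inner (hadamard (F i) (F j)) (F h) =
      (1 / real CARD('v)) * (\<Sum>l\<le>D. q l i j * inner (F l) (F h))"
    using assms by (simp add: hadamard_F inner_sum_left)
  also have "(\<Sum>l\<le>D. q l i j * inner (F l) (F h)) =
      (\<Sum>l\<le>D. if l = h then q h i j * inner (F h) (F h) else 0)"
    using assms inner_F by (intro sum.cong) auto
  finally show ?thesis using assms by simp
qed

text \<open>Up to positive factors, both numbers are the sum over all entries of the product of
  \<open>F 1\<close>, \<open>F i\<close> and \<open>F j\<close>. This carries the vanishing pattern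
  of \<open>q 1 i j\<close> over to the expansion of \<open>hadamard (F 1) (F i)\<close>.\<close>

lemma q_eq_0_swap:
  assumes "i \<le> D" "j \<le> D"
  shows "q j 1 i = 0 \<longleftrightarrow> q 1 i j = 0"
proof -
  have "q j 1 i * inner (F j) (F j) = q 1 i j * inner (F 1) (F 1)"
    using inner_hadamard_F[of 1 i j] inner_hadamard_F[of i j 1] inner_hadamard_swap[of "F 1" "F i" "F j"]
      assms D_pos by simp
  then show ?thesis using F_nonzero[OF \<open>j \<le> D\<close>] F_nonzero[OF D_pos] by auto
qed

text \<open>If \<open>\<tau>\<close> took the same value at \<open>a\<close> and \<open>b\<close>,
  so would every \<open>F i\<close>, by induction: \<open>F 0\<close> is constant, and
  \<open>hadamard (F 1) (F l)\<close> involves \<open>F (Suc l)\<close> with a nonzero coefficient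
  and otherwise only \<open>F h\<close> with \<open>h \<le> l\<close>.\<close>

lemma inj_on_dual_eigenvalues: "inj_on \<tau> {..D}"
proof (rule inj_onI, rule ccontr)
  fix a b assume "a \<in> {..D}" "b \<in> {..D}" and ab: "\<tau> a = \<tau> b" "a \<noteq> b"
  then obtain x1 y1 x2 y2 where xy: "d x1 y1 = a" "d x2 y2 = b"
    using gdist_attained by (metis atMost_iff)
  have \<tau>_coeff: "\<tau> (d x y) * dist_coeff i (d x y) = (1 / real CARD('v)) * (\<Sum>h\<le>D. q h 1 i * dist_coeff h (d x y))"
    if "i \<le> D" for i x y
    using arg_cong[OF hadamard_F[OF D_pos that], of "\<lambda>M. M $ x $ y"] that D_pos
    by (simp add: hadamard_def)
  have "i \<le> D \<longrightarrow> dist_coeff i a = dist_coeff i b" for i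
  proof (induction i rule: less_induct)
    case (less i)
    show ?case
    proof (intro impI, cases i)
      case 0
      then show "dist_coeff i a = dist_coeff i b"
        using F_nth[of 0 x1 y1] F_nth[of 0 x2 y2] xy by (simp add: F_0 del: F_nth)
    next
      case (Suc l)
      assume "i \<le> D"
      have IH: "dist_coeff h a = dist_coeff h b" if "h \<le> l" for h
        using less that Suc \<open>i \<le> D\<close> by simp
      have far: "q h 1 l = 0" if "h \<le> D" "h > i" for h
        using q_1[of l h] q_eq_0_swap[of l h] that Suc by auto
      have "q i 1 l \<noteq> 0"
        using q_1[of l i] q_eq_0_swap[of l i] Suc \<open>i \<le> D\<close> by auto
      have "(\<Sum>h\<le>D. q h 1 l * dist_coeff h a) = (\<Sum>h\<le>D. q h 1 l * dist_coeff h b)"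
        using \<tau>_coeff[of l x1 y1] \<tau>_coeff[of l x2 y2] xy ab IH[of l] Suc \<open>i \<le> D\<close> by simp
      then have "0 = (\<Sum>h\<le>D. q h 1 l * (dist_coeff h a - dist_coeff h b))"
        by (simp add: right_diff_distrib sum_subtractf)
      also have "\<dots> = (\<Sum>h\<in>{i}. q h 1 l * (dist_coeff h a - dist_coeff h b))"
      proof (rule sum.mono_neutral_right)
        show "\<forall>h\<in>{..D} - {i}. q h 1 l * (dist_coeff h a - dist_coeff h b) = 0"
        proof
          fix h assume h: "h \<in> {..D} - {i}"
          then show "q h 1 l * (dist_coeff h a - dist_coeff h b) = 0"
            using IH[of h] far[of h] Suc by (cases "h \<le> l") auto
        qed
      qed (use \<open>i \<le> D\<close> in auto)
      finally show "dist_coeff i a = dist_coeff i b" using \<open>q i 1 l \<noteq> 0\<close> by simp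
    qed
  qed
  \<comment> \<open>The \<open>F i\<close> span the algebra, which contains the distance matrix for
    \<open>a\<close>; that matrix does tell \<open>a\<close> from \<open>b\<close>.\<close>
  moreover obtain g where "dmat (\<lambda>h. if h = a then 1 else 0) = (\<Sum>i\<le>D. g i *\<^sub>R F i)"
    using bose_mesner_expansion[of "dmat (\<lambda>h. if h = a then 1 else 0)"] by (auto simp: bose_mesner_eq)
  then have "(if d x y = a then 1 else 0) = (\<Sum>i\<le>D. g i * dist_coeff i (d x y))" for x y
    by (auto simp: vec_eq_iff)
  from this[of x1 y1] this[of x2 y2] have "(\<Sum>i\<le>D. g i * dist_coeff i a) = 1" "(\<Sum>i\<le>D. g i * dist_coeff i b) = 0"
    using xy ab by auto
  ultimately show False by simp
qed

text \<open>Terwilliger's dual adjacency matrix with respect to \<open>x\<close>, without the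
  customary factor \<open>CARD('v)\<close>.\<close>

definition dual_adjacency :: "'v \<Rightarrow> real^'v^'v" where
  "dual_adjacency x = (\<chi> y z. if y = z then \<tau> (d x y) else 0)"

lemma mult_dual_adjacency [simp]:
  "(A ** dual_adjacency x) $ y $ z = A $ y $ z * \<tau> (d x z)"
  "(dual_adjacency x ** A) $ y $ z = \<tau> (d x y) * A $ y $ z"
  by (simp_all add: dual_adjacency_def matrix_matrix_mult_def if_distrib if_distribR cong: if_cong)

text \<open>The squared norm of the left-hand side is, up to a constant, the Krein parameter.\<close>

lemma triple_product_eq_0:
  assumes ij: "i \<le> D" "j \<le> D" and q: "q 1 i j = 0"
  shows "F i ** dual_adjacency x ** F j = 0"
proof -
  let ?T = "dual_adjacency x"
  define V where "V = F i ** ?T ** F j"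
  have tr: "transpose (F l) = F l" if "l \<le> D" for l
    using that by (simp add: vec_eq_iff transpose_def gdist_sym)
  have trT: "transpose ?T = ?T"
    by (simp add: vec_eq_iff transpose_def dual_adjacency_def)
  have absorb: "F l ** (F l ** Z) = F l ** Z" if "l \<le> D" for l and Z :: "real^'v^'v"
    using that by (simp add: matrix_mul_assoc F_idem)
  have V_t: "transpose V = F j ** (?T ** F i)"
    unfolding V_def using ij by (simp add: matrix_transpose_mul tr trT)
  have "inner V V = trace (V ** transpose V)"
    by (simp add: inner_matrix trace_def matrix_matrix_mult_def transpose_def)
  also have "V ** transpose V = (F i ** ?T ** F j ** ?T) ** F i"
    unfolding V_t unfolding V_def using ij by (simp only: matrix_mul_assoc[symmetric] absorb)
  also have "trace \<dots> = trace (F i ** (F i ** ?T ** F j ** ?T))"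
    by (rule trace_mul_sym)
  also have "F i ** (F i ** ?T ** F j ** ?T) = (F i ** ?T) ** (F j ** ?T)"
    using ij by (simp only: matrix_mul_assoc[symmetric] absorb)
  \<comment> \<open>In this double sum \<open>F i\<close> and \<open>F j\<close> meet at the same
    entry, which produces their Hadamard product. The diagonal entries of the two dual adjacency
    matrices become a row and a column of \<open>F 1\<close>, and multiplying by \<open>F 1\<close>
    singles out the coefficient \<open>q 1 i j\<close>.\<close>
  also have "trace \<dots> = (\<Sum>y\<in>UNIV. \<Sum>z\<in>UNIV. F 1 $ x $ z * (hadamard (F i) (F j) $ z $ y * F 1 $ y $ x))"
    unfolding trace_def matrix_matrix_mult_def[of "F i ** ?T"]
    unfolding vec_lambda_beta using ij D_pos
    by (intro sum.cong refl) (simp add: hadamard_def gdist_sym mult_ac)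
  also have "\<dots> = (F 1 ** (hadamard (F i) (F j) ** F 1)) $ x $ x"
    unfolding matrix_matrix_mult_def vec_lambda_beta sum_distrib_left by (rule sum.swap)
  also have "F 1 ** (hadamard (F i) (F j) ** F 1) = 0"
    using combination_mult_F(1)[OF D_pos, of "\<lambda>h. q h i j"] q ij
    by (simp add: hadamard_F matrix_mult_linear_simps)
  finally have "V = 0" by simp
  then show ?thesis by (simp add: V_def)
qed

text \<open>The \<open>F i\<close> sum to the identity, so \<open>Z\<close> is the sum of its
  corners.\<close>

lemma eq_0_if_corners_eq_0:
  assumes "\<And>i j. i \<le> D \<Longrightarrow> j \<le> D \<Longrightarrow> F i ** Z ** F j = 0"
  shows "Z = 0"
proof -
  have "Z = (\<Sum>i\<le>D. F i) ** Z ** (\<Sum>j\<le>D. F j)" by (simp add: sum_F)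
  also have "\<dots> = (\<Sum>i\<le>D. \<Sum>j\<le>D. F i ** Z ** F j)"
    by (simp add: matrix_mult_linear_simps) (rule sum.swap)
  also have "\<dots> = 0" using assms by simp
  finally show ?thesis .
qed

text \<open>In the corner between \<open>F i\<close> and \<open>F j\<close> both sides are multiples
  of \<open>F i ** dual_adjacency x ** F j\<close>, which vanishes unless \<open>i\<close> and
  \<open>j\<close> differ by at most 1. So only the scalars for neighbouring indices have to agree,
  and these can be matched by one \<open>R\<close> for all \<open>x\<close>.\<close>

lemma commutator_dual_adjacency:
  assumes G: "G \<in> bose_mesner E" and H: "H \<in> bose_mesner E"
  obtains R where "R \<in> bose_mesner E"
    "\<And>x. G ** dual_adjacency x ** H - H ** dual_adjacency x ** G =
      R ** dual_adjacency x - dual_adjacency x ** R"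
proof -
  obtain g where g: "\<And>i. i \<le> D \<Longrightarrow> G ** F i = g i *\<^sub>R F i" "\<And>i. i \<le> D \<Longrightarrow> F i ** G = g i *\<^sub>R F i"
    using eigenvalues[OF G] by blast
  obtain h where h: "\<And>i. i \<le> D \<Longrightarrow> H ** F i = h i *\<^sub>R F i" "\<And>i. i \<le> D \<Longrightarrow> F i ** H = h i *\<^sub>R F i"
    using eigenvalues[OF H] by blast
  \<comment> \<open>Partial sums solve
    \<open>s i - s (Suc i) = g i * h (Suc i) - h i * g (Suc i)\<close>; the condition for the
    opposite order of indices is its negative.\<close>
  define s where "s i = - (\<Sum>l<i. g l * h (Suc l) - h l * g (Suc l))" for i
  define R where "R = (\<Sum>i\<le>D. s i *\<^sub>R F i)"
  have "R \<in> bose_mesner E"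
    unfolding R_def using subspace_bose_mesner F_in by (intro subspace_sum subspace_scale) auto
  moreover have "G ** dual_adjacency x ** H - H ** dual_adjacency x ** G =
      R ** dual_adjacency x - dual_adjacency x ** R" for x
  proof -
    let ?T = "dual_adjacency x"
    have "F i ** (G ** ?T ** H - H ** ?T ** G - (R ** ?T - ?T ** R)) ** F j = 0"
      if ij: "i \<le> D" "j \<le> D" for i j
    proof -
      have R: "R ** F j = s j *\<^sub>R F j" "F i ** R = s i *\<^sub>R F i"
        unfolding R_def using combination_mult_F ij by auto
      have GH: "F i ** (G ** ?T ** H) ** F j = (g i * h j) *\<^sub>R (F i ** ?T ** F j)"
      proof -
        have "F i ** (G ** ?T ** H) ** F j = (F i ** G) ** ?T ** (H ** F j)"
          by (simp add: matrix_mul_assoc)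
        then show ?thesis using g h ij by (simp add: matrix_mult_linear_simps)
      qed
      have HG: "F i ** (H ** ?T ** G) ** F j = (h i * g j) *\<^sub>R (F i ** ?T ** F j)"
      proof -
        have "F i ** (H ** ?T ** G) ** F j = (F i ** H) ** ?T ** (G ** F j)"
          by (simp add: matrix_mul_assoc)
        then show ?thesis using g h ij by (simp add: matrix_mult_linear_simps)
      qed
      have RT: "F i ** (R ** ?T) ** F j = s i *\<^sub>R (F i ** ?T ** F j)"
        using R by (simp add: matrix_mul_assoc matrix_mult_linear_simps)
      have TR: "F i ** (?T ** R) ** F j = s j *\<^sub>R (F i ** ?T ** F j)"
      proof -
        have "F i ** (?T ** R) ** F j = F i ** ?T ** (R ** F j)"
          by (simp add: matrix_mul_assoc)
        then show ?thesis using R by (simp add: matrix_mult_linear_simps)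
      qed
      have "F i ** (G ** ?T ** H - H ** ?T ** G - (R ** ?T - ?T ** R)) ** F j =
          (g i * h j - h i * g j - (s i - s j)) *\<^sub>R (F i ** ?T ** F j)"
        by (simp add: linear_diff[OF linear_matrix_mult_left] linear_diff[OF linear_matrix_mult_right]
            GH HG RT TR scaleR_diff_left)
      moreover have "g i * h j - h i * g j = s i - s j" if "j = Suc i \<or> i = Suc j \<or> i = j"
        using that by (auto simp: s_def)
      moreover have "F i ** ?T ** F j = 0" if "\<not> (j = Suc i \<or> i = Suc j \<or> i = j)"
        using q_1[OF ij] that by (intro triple_product_eq_0 ij) auto
      ultimately show ?thesis by (metis diff_self scaleR_zero_left scaleR_zero_right)
    qed
    then have "G ** ?T ** H - H ** ?T ** G - (R ** ?T - ?T ** R) = 0"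
      by (rule eq_0_if_corners_eq_0)
    then show ?thesis by simp
  qed
  ultimately show ?thesis by (rule that)
qed

text \<open>Terwilliger's balanced set condition, paired with the column of \<open>F 1\<close> at \<open>x\<close>.\<close>

lemma balanced_set_condition:
  obtains r where "\<And>x y z. (\<Sum>w \<in> S i y \<inter> S j z. \<tau> (d x w)) - (\<Sum>w \<in> S j y \<inter> S i z. \<tau> (d x w)) =
    r (d y z) * (\<tau> (d x y) - \<tau> (d x z))"
proof -
  define A where "A l = dmat (\<lambda>h. if h = l then 1 else 0)" for l
  have A: "A l \<in> bose_mesner E" for l by (simp add: A_def bose_mesner_eq)
  obtain R where "R \<in> bose_mesner E" and R: "\<And>x. A i ** dual_adjacency x ** A j - A j ** dual_adjacency x ** A i =
      R ** dual_adjacency x - dual_adjacency x ** R"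
    using commutator_dual_adjacency[OF A A] by blast
  then obtain \<rho> where \<rho>: "R = dmat \<rho>" by (auto simp: bose_mesner_eq)
  have ATA: "(A l ** dual_adjacency x ** A m) $ y $ z = (\<Sum>w \<in> S l y \<inter> S m z. \<tau> (d x w))" for l m x y z
  proof -
    have "(A l ** dual_adjacency x ** A m) $ y $ z =
        (\<Sum>w\<in>UNIV. if w \<in> S l y \<inter> S m z then \<tau> (d x w) else 0)"
      unfolding matrix_matrix_mult_def[of "A l ** dual_adjacency x"] mult_dual_adjacency vec_lambda_beta
      by (intro sum.cong) (auto simp: A_def gdist_sym)
    also have "\<dots> = (\<Sum>w \<in> UNIV \<inter> (S l y \<inter> S m z). \<tau> (d x w))"
      by (rule sum.inter_restrict[symmetric]) simp
    finally show ?thesis by simp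
  qed
  \<comment> \<open>At the entry \<open>y\<close>, \<open>z\<close> the right-hand side of
    \<open>R\<close> is \<open>\<rho> (d y z) * (\<tau> (d x z) - \<tau> (d x y))\<close>, whence
    the sign. The function \<open>\<rho>\<close> is the same for all \<open>x\<close>.\<close>
  have "(\<Sum>w \<in> S i y \<inter> S j z. \<tau> (d x w)) - (\<Sum>w \<in> S j y \<inter> S i z. \<tau> (d x w)) =
      - \<rho> (d y z) * (\<tau> (d x y) - \<tau> (d x z))" for x y z
    using arg_cong[OF R, of "\<lambda>M. M $ y $ z" x] by (simp add: ATA \<rho> algebra_simps)
  then show ?thesis using that[of "\<lambda>h. - \<rho> h"] by simp
qed

text \<open>The columns of \<open>F 1\<close> are eigenvectors of the adjacency matrix, which lies
  in the Bose-Mesner algebra.\<close>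

lemma eigenvalue_equation:
  obtains \<theta> where "\<And>x y. (\<Sum>w \<in> S 1 y. \<tau> (d x w)) = \<theta> * \<tau> (d x y)"
proof -
  define A where "A = dmat (\<lambda>h. if h = 1 then 1 else 0)"
  have "A \<in> bose_mesner E" by (simp add: A_def bose_mesner_eq)
  then obtain g where "\<And>i. i \<le> D \<Longrightarrow> A ** F i = g i *\<^sub>R F i"
    using eigenvalues[of A] by blast
  then have g: "(A ** F 1) $ y $ x = g 1 * \<tau> (d x y)" for x y
    using D_pos by (simp add: gdist_sym)
  have "(\<Sum>w \<in> S 1 y. \<tau> (d x w)) = g 1 * \<tau> (d x y)" for x y
  proof -
    have "(\<Sum>w \<in> UNIV \<inter> S 1 y. \<tau> (d x w)) = (\<Sum>w\<in>UNIV. if w \<in> S 1 y then \<tau> (d x w) else 0)"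
      by (rule sum.inter_restrict) simp
    also have "\<dots> = (A ** F 1) $ y $ x"
      unfolding matrix_matrix_mult_def vec_lambda_beta
      using D_pos by (intro sum.cong) (auto simp: A_def gdist_sym)
    finally show ?thesis using g by simp
  qed
  then show ?thesis by (rule that)
qed

end

section \<open>Bipartite graphs\<close>

context distance_regular_graph
begin

abbreviation c :: "nat \<Rightarrow> nat" where "c \<equiv> c_number E"

lemma card_S_1_Int: "d x y = i \<Longrightarrow> card (S 1 y \<inter> S (i - 1) x) = c i"
  using card_S_Int_S[of y x i] by (simp add: c_number_def gdist_sym)

lemma c_pos:
  assumes "1 \<le> i" "i \<le> D"
  shows "1 \<le> c i"
proof -
  obtain x y where xy: "d x y = i" using gdist_attained[OF assms(2)] .
  then obtain w where "d x w = i - 1" "d w y = 1"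
    using geodesic[of x y "i - 1" 1] assms by auto
  then have "w \<in> S 1 y \<inter> S (i - 1) x" using gdist_sym[of w y] by simp
  then have "card (S 1 y \<inter> S (i - 1) x) \<noteq> 0" by auto
  then show ?thesis using card_S_1_Int[OF xy] by linarith
qed

lemma c_1: "1 \<le> D \<Longrightarrow> c 1 = 1"
proof -
  assume "1 \<le> D"
  then obtain x y where xy: "d x y = 1" using gdist_attained by metis
  then have "S 1 y \<inter> S (1 - 1) x = {x}" using gdist_sym[of x y] by auto
  then show ?thesis using card_S_1_Int[OF xy] by simp
qed

text \<open>Moving \<open>x\<close> one step along a geodesic to \<open>y\<close> gives
  \<open>w\<close>, and every neighbour of \<open>y\<close> that is closer to \<open>w\<close> is
  also closer to \<open>x\<close>.\<close>

lemma c_mono: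
  assumes "1 \<le> i" "Suc i \<le> D"
  shows "c i \<le> c (Suc i)"
proof -
  obtain x y where xy: "d x y = Suc i" using gdist_attained[OF assms(2)] .
  then obtain w where w: "d x w = 1" "d w y = i"
    using geodesic[of x y 1 i] assms by auto
  have "S 1 y \<inter> S (i - 1) w \<subseteq> S 1 y \<inter> S (Suc i - 1) x"
  proof
    fix u assume u: "u \<in> S 1 y \<inter> S (i - 1) w"
    then have "d x u \<le> i" using gdist_triangle[of x u w] w assms by simp
    moreover have "d u y = 1" using u gdist_sym[of u y] by simp
    then have "Suc i \<le> d x u + 1" using gdist_triangle[of x y u] xy by linarith
    ultimately show "u \<in> S 1 y \<inter> S (Suc i - 1) x" using u by simp
  qed
  then have "card (S 1 y \<inter> S (i - 1) w) \<le> card (S 1 y \<inter> S (Suc i - 1) x)"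
    by (intro card_mono) auto
  then show ?thesis using card_S_1_Int[OF w(2)] card_S_1_Int[OF xy] by simp
qed

text \<open>The parity of a walk's length is decided by whether its ends have the same
  colour.\<close>

lemma gdist_parity:
  assumes "bipartite E"
  shows "even (d x y + d y z + d x z)"
proof -
  obtain P where P: "\<And>x y. (x, y) \<in> E \<Longrightarrow> x \<in> P \<longleftrightarrow> y \<notin> P"
  proof -
    obtain P Q where PQ: "P \<union> Q = UNIV \<and> P \<inter> Q = {} \<and>
        (\<forall>(x, y)\<in>E. (x \<in> P \<and> y \<in> Q) \<or> (x \<in> Q \<and> y \<in> P))"
      using assms unfolding bipartite_def by (elim exE) (rule that)
    then have "x \<in> P \<longleftrightarrow> y \<notin> P" if "(x, y) \<in> E" for x y
      using bspec[OF conjunct2[OF conjunct2[OF PQ]] that] PQ by auto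
    then show ?thesis by (rule that)
  qed
  have "even n \<longleftrightarrow> (x \<in> P \<longleftrightarrow> y \<in> P)" if "(x, y) \<in> E ^^ n" for x y n
    using that
  proof (induction n arbitrary: y)
    case (Suc n)
    then obtain w where "(x, w) \<in> E ^^ n" "(w, y) \<in> E" by auto
    then show ?case using Suc.IH P by auto
  qed auto
  then have "even (d x y) \<longleftrightarrow> (x \<in> P \<longleftrightarrow> y \<in> P)" for x y
    using gdist_walk by blast
  then show ?thesis by auto
qed

lemma bipartite_neighbour:
  assumes "bipartite E" and w: "d y w = 1"
  shows "d x w = d x y + 1 \<or> d x y = d x w + 1"
proof -
  have "odd (d x y + d x w)" using gdist_parity[OF assms(1), of x y w] w by simp
  then show ?thesis using gdist_edge[OF w, of x] by presburger
qed

end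

locale bipartite_distance_regular_graph = distance_regular_graph E for E :: "'v::finite rel" +
  fixes k :: nat
  assumes bipartite: "bipartite E" and regular: "regular_graph E k"
begin

lemma card_S_1: "card (S 1 x) = k"
proof -
  have "S 1 x = E `` {x}" by auto
  then show ?thesis using regular by (simp add: regular_graph_def)
qed

lemma S_1_split:
  assumes "d x y = i" "1 \<le> i"
  shows "S 1 y = (S 1 y \<inter> S (i - 1) x) \<union> (S 1 y \<inter> S (i + 1) x)"
    and "(S 1 y \<inter> S (i - 1) x) \<inter> (S 1 y \<inter> S (i + 1) x) = {}"
  using bipartite_neighbour[OF bipartite, of y _ x] assms by fastforce+

lemma card_S_1_Int_Suc:
  assumes "d x y = i" "1 \<le> i"
  shows "c i + card (S 1 y \<inter> S (i + 1) x) = k"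
proof -
  have "card (S 1 y) = card (S 1 y \<inter> S (i - 1) x) + card (S 1 y \<inter> S (i + 1) x)"
    by (subst S_1_split(1)[OF assms], rule card_Un_disjoint) (use S_1_split(2)[OF assms] in auto)
  then show ?thesis using card_S_1 card_S_1_Int[OF assms(1)] by simp
qed

lemma c_diameter: "1 \<le> D \<Longrightarrow> c D = k"
proof -
  assume "1 \<le> D"
  obtain x y where xy: "d x y = D" using gdist_attained[of D] by auto
  have "w \<notin> S (D + 1) x" for w using gdist_le_diameter[of x w] by simp
  then have "S (D + 1) x = {}" by blast
  then show ?thesis using card_S_1_Int_Suc[OF xy \<open>1 \<le> D\<close>] by simp
qed

lemma sum_neighbours:
  assumes "d x y = i" "1 \<le> i"
  shows "(\<Sum>w \<in> S 1 y. f (d x w)) = real (c i) * f (i - 1) + (real k - real (c i)) * f (i + 1)"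
proof -
  have "(\<Sum>w \<in> S 1 y. f (d x w)) =
      (\<Sum>w \<in> S 1 y \<inter> S (i - 1) x. f (d x w)) + (\<Sum>w \<in> S 1 y \<inter> S (i + 1) x. f (d x w))"
    by (subst S_1_split(1)[OF assms], rule sum.union_disjoint) (use S_1_split(2)[OF assms] in auto)
  also have "(\<Sum>w \<in> S 1 y \<inter> S (i - 1) x. f (d x w)) = (\<Sum>w \<in> S 1 y \<inter> S (i - 1) x. f (i - 1))"
    by (intro sum.cong) auto
  also have "(\<Sum>w \<in> S 1 y \<inter> S (i + 1) x. f (d x w)) = (\<Sum>w \<in> S 1 y \<inter> S (i + 1) x. f (i + 1))"
    by (intro sum.cong) auto
  moreover have "real (card (S 1 y \<inter> S (i + 1) x)) = real k - real (c i)"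
    using card_S_1_Int_Suc[OF assms] by linarith
  ultimately show ?thesis using card_S_1_Int[OF assms(1)] by simp
qed

section \<open>Triples of vertices at distances 2, 3, 3 when \<open>c 2 = 1\<close>, and the
  girth\<close>

lemma unique_common_neighbour:
  assumes "c 2 = 1" "d y u = 1" "d u x = 1" "x \<noteq> y"
  shows "d x y = 2" "S 1 y \<inter> S 1 x = {u}"
proof -
  have "even (d x y)"
    using gdist_parity[OF bipartite, of y u x] assms(2,3) gdist_sym[of x y] by simp
  then have "d x y \<noteq> 1" by (metis odd_one)
  moreover have "d x y \<noteq> 0" "d x y \<le> 2"
    using assms(4) gdist_triangle[of y x u] assms(2,3) gdist_sym[of x y] by auto
  ultimately show xy: "d x y = 2" by linarith
  have "card (S 1 y \<inter> S 1 x) = 1"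
    using card_S_1_Int[OF xy] assms(1) by simp
  moreover have "u \<in> S 1 y \<inter> S 1 x" using assms(2,3) gdist_sym[of u x] by simp
  ultimately show "S 1 y \<inter> S 1 x = {u}" by (metis card_1_singletonE singletonD)
qed

text \<open>Take \<open>u\<close> at distance 2 from \<open>z\<close>. It has \<open>k - 1\<close>
  neighbours at distance 3 from \<open>z\<close>, and two of them serve as \<open>x\<close> and
  \<open>y\<close>; their only common neighbour \<open>u\<close> is counted.\<close>

lemma exists_neighbour_toward:
  assumes "c 2 = 1" "3 \<le> k" "3 \<le> D"
  obtains x y z where "d x y = 2" "d y z = 3" "d x z = 3" "card (S 1 y \<inter> S 2 z \<inter> S 1 x) = 1"
proof -
  obtain y z where yz: "d y z = 1 + 2" using gdist_attained[of "1 + 2"] assms by auto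
  then obtain u where u: "d y u = 1" "d u z = 2" by (rule geodesic)
  have yz3: "d y z = 3" using yz by simp
  have "c 2 + card (S 1 u \<inter> S 3 z) = k"
    using card_S_1_Int_Suc[of z u 2] u gdist_sym[of u z] by simp
  then have "card (S 1 u \<inter> S 3 z - {y}) \<noteq> 0"
    using assms by (simp add: card_Diff_singleton_if)
  then have "S 1 u \<inter> S 3 z - {y} \<noteq> {}" by (metis card.empty)
  then obtain x where "x \<in> S 1 u \<inter> S 3 z - {y}" by blast
  then have x: "d u x = 1" "d z x = 3" "x \<noteq> y" by auto
  have "u \<in> S 2 z" using u(2) gdist_sym[of u z] by simp
  then have "S 1 y \<inter> S 2 z \<inter> S 1 x = {u}"
    using unique_common_neighbour(2)[OF assms(1) u(1) x(1,3)] by blast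
  then show ?thesis
    using that unique_common_neighbour(1)[OF assms(1) u(1) x(1,3)] yz3 x gdist_sym[of x z] by simp
qed

text \<open>Now \<open>u\<close> is at distance 4 from \<open>z\<close>, and \<open>x\<close>,
  \<open>y\<close> are two of its \<open>c 4\<close> neighbours at distance 3 from \<open>z\<close>.
  Their only common neighbour \<open>u\<close> is too far from \<open>z\<close> to be
  counted.\<close>

lemma exists_neighbour_away:
  assumes "c 2 = 1" "2 \<le> c 4" "4 \<le> D"
  obtains x y z where "d x y = 2" "d y z = 3" "d x z = 3" "card (S 1 y \<inter> S 2 z \<inter> S 1 x) = 0"
proof -
  obtain u z where uz: "d u z = 1 + 3" using gdist_attained[of "1 + 3"] assms by auto
  then obtain y where y: "d u y = 1" "d y z = 3" by (rule geodesic)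
  have "card (S 1 u \<inter> S 3 z) = c 4"
    using card_S_1_Int[of z u 4] uz gdist_sym[of u z] by simp
  then have "card (S 1 u \<inter> S 3 z - {y}) \<noteq> 0"
    using assms by (simp add: card_Diff_singleton_if)
  then have "S 1 u \<inter> S 3 z - {y} \<noteq> {}" by (metis card.empty)
  then obtain x where "x \<in> S 1 u \<inter> S 3 z - {y}" by blast
  then have x: "d u x = 1" "d z x = 3" "x \<noteq> y" by auto
  have yu: "d y u = 1" using y(1) gdist_sym[of u y] by simp
  have "u \<notin> S 2 z" using uz gdist_sym[of u z] by simp
  then have "S 1 y \<inter> S 1 x \<inter> S 2 z = {}"
    unfolding unique_common_neighbour(2)[OF assms(1) yu x(1,3)] by blast
  then have "S 1 y \<inter> S 2 z \<inter> S 1 x = {}" by blast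
  then show ?thesis
    using that unique_common_neighbour(1)[OF assms(1) yu x(1,3)] y x gdist_sym[of x z] by simp
qed

text \<open>Two common neighbours of vertices at distance 2 close a 4-cycle, and parity excludes
  triangles.\<close>

lemma girth_eq_4:
  assumes "2 \<le> c 2" "2 \<le> D"
  shows "girth E = 4"
proof (rule antisym)
  obtain x y where xy: "d x y = 2" using gdist_attained[OF assms(2)] .
  then have "x \<noteq> y" using gdist_eq_0[of x y] by linarith
  have "1 < card (S 1 y \<inter> S 1 x)" using card_S_1_Int[OF xy] assms by simp
  then obtain u v where uv: "u \<in> S 1 y \<inter> S 1 x" "v \<in> S 1 y \<inter> S 1 x" "u \<noteq> v"
    by (metis One_nat_def card_le_Suc0_iff_eq finite leD)
  have "is_cycle E [x, u, y, v]"
    unfolding is_cycle_def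
  proof (intro conjI allI impI)
    show "distinct [x, u, y, v]"
      using uv irrefl_E \<open>x \<noteq> y\<close> by (auto simp: irrefl_def)
    show "([x, u, y, v] ! i, [x, u, y, v] ! (Suc i mod length [x, u, y, v])) \<in> E"
      if "i < length [x, u, y, v]" for i
    proof -
      have "i = 0 \<or> i = 1 \<or> i = 2 \<or> i = 3" using that by auto
      moreover have "(x, u) \<in> E" "(u, y) \<in> E" "(y, v) \<in> E" "(v, x) \<in> E"
        using uv sym_E by (simp_all add: sym_def)
      ultimately show ?thesis by auto
    qed
  qed simp
  then have "girth E \<le> enat (length [x, u, y, v])"
    unfolding girth_def by (intro INF_lower) simp
  moreover have "length [x, u, y, v] = 4" by simp
  ultimately show "girth E \<le> 4" by (simp only: numeral_eq_enat)
  show "4 \<le> girth E"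
    unfolding girth_def
  proof (rule INF_greatest)
    fix l assume "l \<in> {l. is_cycle E l}"
    then have l: "length l \<ge> 3" and edge: "\<And>i. i < length l \<Longrightarrow> (l ! i, l ! (Suc i mod length l)) \<in> E"
      by (auto simp: is_cycle_def)
    have "length l \<noteq> 3"
    proof
      assume len: "length l = 3"
      then have "(l ! 0, l ! 1) \<in> E" "(l ! 1, l ! 2) \<in> E" "(l ! 2, l ! 0) \<in> E"
        using edge[of 0] edge[of 1] edge[of 2] unfolding len by (simp_all add: numeral_2_eq_2)
      then have edges: "d (l ! 0) (l ! 1) = 1" "d (l ! 1) (l ! 2) = 1" "d (l ! 0) (l ! 2) = 1"
        unfolding gdist_eq_1 using sym_E by (auto dest: symD)
      show False
        using gdist_parity[OF bipartite, of "l ! 0" "l ! 1" "l ! 2"] unfolding edges by simp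
    qed
    then have "4 \<le> length l" using l by simp
    then show "4 \<le> enat (length l)" by (simp add: numeral_eq_enat)
  qed
qed

end

section \<open>The balanced set condition for geodesics and for triangles\<close>

context Q_polynomial_graph
begin

text \<open>All vertices of the two sets lie on geodesics from \<open>x\<close> to \<open>z\<close>,
  so each sum consists of \<open>c 3\<close> equal terms.\<close>

lemma balanced_set_condition_geodesic:
  assumes r: "\<And>x y z. (\<Sum>w \<in> S 1 y \<inter> S 2 z. \<tau> (d x w)) - (\<Sum>w \<in> S 2 y \<inter> S 1 z. \<tau> (d x w)) =
      r (d y z) * (\<tau> (d x y) - \<tau> (d x z))"
    and i: "i + 3 \<le> D"
  shows "real (c 3) * (\<tau> (i + 1) - \<tau> (i + 2)) = r 3 * (\<tau> i - \<tau> (i + 3))"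
proof -
  obtain x z where xz: "d x z = i + 3" using gdist_attained[OF i] .
  then obtain y where y: "d x y = i" "d y z = 3" by (rule geodesic)
  have "d x w = i + 1" if "w \<in> S 1 y \<inter> S 2 z" for w
    using that gdist_edge[of y w x] gdist_triangle[of x z w] gdist_sym[of w z] xz y by simp
  then have "(\<Sum>w \<in> S 1 y \<inter> S 2 z. \<tau> (d x w)) = (\<Sum>w \<in> S 1 y \<inter> S 2 z. \<tau> (i + 1))"
    by (intro sum.cong) auto
  moreover have "card (S 1 y \<inter> S 2 z) = c 3"
    using card_S_1_Int[of z y 3] y gdist_sym[of y z] by simp
  moreover have "d x w = i + 2" if "w \<in> S 2 y \<inter> S 1 z" for w
    using that gdist_edge[of z w x] gdist_triangle[of x w y] xz y by simp
  then have "(\<Sum>w \<in> S 2 y \<inter> S 1 z. \<tau> (d x w)) = (\<Sum>w \<in> S 2 y \<inter> S 1 z. \<tau> (i + 2))"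
    by (intro sum.cong) auto
  moreover have "card (S 2 y \<inter> S 1 z) = c 3"
    using card_S_1_Int[of y z 3] y by (simp add: Int_commute)
  ultimately show ?thesis using r[where x=x and y=y and z=z] xz y by (simp add: algebra_simps)
qed

end

locale bipartite_Q_polynomial_graph = Q_polynomial_graph E F q + bipartite_distance_regular_graph E k
  for E :: "'v::finite rel" and F q k
begin

lemma dual_eigenvalue_recurrence:
  obtains \<theta> where "real k * \<tau> 1 = \<theta> * \<tau> 0"
    "\<And>i. 1 \<le> i \<Longrightarrow> i \<le> D \<Longrightarrow>
      real (c i) * \<tau> (i - 1) + (real k - real (c i)) * \<tau> (i + 1) = \<theta> * \<tau> i"
proof -
  obtain \<theta> where \<theta>: "\<And>x y. (\<Sum>w \<in> S 1 y. \<tau> (d x w)) = \<theta> * \<tau> (d x y)"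
    using eigenvalue_equation by blast
  have "(\<Sum>w \<in> S 1 x. \<tau> (d x w)) = (\<Sum>w \<in> S 1 x. \<tau> 1)" for x
    by (intro sum.cong refl) (simp only: mem_S)
  moreover have d_self: "d x x = 0" for x by simp
  \<comment> \<open>Any vertex serves, so \<open>undefined\<close> is taken.\<close>
  ultimately have "real k * \<tau> 1 = \<theta> * \<tau> 0"
    using \<theta>[of undefined undefined] card_S_1[of undefined] unfolding d_self by simp
  moreover have "real (c i) * \<tau> (i - 1) + (real k - real (c i)) * \<tau> (i + 1) = \<theta> * \<tau> i"
    if i: "1 \<le> i" "i \<le> D" for i
  proof -
    obtain x y where xy: "d x y = i" using gdist_attained[OF i(2)] .
    then show ?thesis using sum_neighbours[OF xy i(1), of \<tau>] \<theta>[of x y] by simp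
  qed
  ultimately show ?thesis by (rule that)
qed

text \<open>Bipartiteness leaves only the distances 1 and 3 from \<open>x\<close> on the first set,
  and 2 and 4 on the second. The witness \<open>f\<close> counts the vertices of the second set at
  distance 4.\<close>

lemma balanced_set_condition_triangle:
  assumes r: "\<And>x y z. (\<Sum>w \<in> S 1 y \<inter> S 2 z. \<tau> (d x w)) - (\<Sum>w \<in> S 2 y \<inter> S 1 z. \<tau> (d x w)) =
      r (d y z) * (\<tau> (d x y) - \<tau> (d x z))"
    and xyz: "d x y = 2" "d y z = 3" "d x z = 3"
  obtains f where "real (card (S 1 y \<inter> S 2 z \<inter> S 1 x)) * (\<tau> 1 - \<tau> 3) + real f * (\<tau> 2 - \<tau> 4) =
      r 3 * (\<tau> 2 - \<tau> 3) + real (c 3) * (\<tau> 2 - \<tau> 3)"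
proof -
  define A where "A = S 1 y \<inter> S 2 z"
  define B where "B = S 2 y \<inter> S 1 z"
  have cA: "card A = c 3"
    using card_S_1_Int[of z y 3] xyz gdist_sym[of y z] by (simp add: A_def)
  have cB: "card B = c 3"
    using card_S_1_Int[of y z 3] xyz by (simp add: B_def Int_commute)
  have two_values: "(\<Sum>w\<in>C. \<tau> (d x w)) =
      real (card (C \<inter> S i x)) * \<tau> i + (real (card C) - real (card (C \<inter> S i x))) * \<tau> j"
    if "\<And>w. w \<in> C \<Longrightarrow> d x w = i \<or> d x w = j" for C i j
  proof -
    have "(\<Sum>w\<in>C. \<tau> (d x w)) = (\<Sum>w\<in>C. (if w \<in> S i x then \<tau> i - \<tau> j else 0) + \<tau> j)"
      using that by (intro sum.cong) auto
    also have "\<dots> = (\<Sum>w \<in> C \<inter> S i x. \<tau> i - \<tau> j) + real (card C) * \<tau> j"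
      unfolding sum.distrib sum.inter_restrict[OF finite, symmetric] by simp
    finally show ?thesis by (simp add: algebra_simps)
  qed
  have "d x w = 1 \<or> d x w = 3" if "w \<in> A" for w
    using bipartite_neighbour[OF bipartite, of y w x] that xyz
    unfolding A_def Int_iff mem_S by arith
  then have "(\<Sum>w\<in>A. \<tau> (d x w)) =
      real (card (A \<inter> S 1 x)) * \<tau> 1 + (real (c 3) - real (card (A \<inter> S 1 x))) * \<tau> 3"
    using two_values[of A 1 3] cA by simp
  moreover have "d x w = 4 \<or> d x w = 2" if "w \<in> B" for w
    using bipartite_neighbour[OF bipartite, of z w x] that xyz
    unfolding B_def Int_iff mem_S by arith
  then have "(\<Sum>w\<in>B. \<tau> (d x w)) =
      real (card (B \<inter> S 4 x)) * \<tau> 4 + (real (c 3) - real (card (B \<inter> S 4 x))) * \<tau> 2"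
    using two_values[of B 4 2] cB by simp
  ultimately have "real (card (A \<inter> S 1 x)) * (\<tau> 1 - \<tau> 3) + real (card (B \<inter> S 4 x)) * (\<tau> 2 - \<tau> 4) =
      r 3 * (\<tau> 2 - \<tau> 3) + real (c 3) * (\<tau> 2 - \<tau> 3)"
    using r[where x=x and y=y and z=z, folded A_def B_def] xyz by (simp add: algebra_simps)
  then show ?thesis using that unfolding A_def by blast
qed

lemma c_2_ne_1:
  assumes D: "D = 5" and k: "3 \<le> k"
  shows "c 2 \<noteq> 1"
proof
  assume c2: "c 2 = 1"
  obtain r where r: "\<And>x y z. (\<Sum>w \<in> S 1 y \<inter> S 2 z. \<tau> (d x w)) - (\<Sum>w \<in> S 2 y \<inter> S 1 z. \<tau> (d x w)) =
      r (d y z) * (\<tau> (d x y) - \<tau> (d x z))"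
    using balanced_set_condition[of 1 2] by blast
  obtain \<theta> where \<theta>0: "real k * \<tau> 1 = \<theta> * \<tau> 0"
    and \<theta>: "\<And>i. 1 \<le> i \<Longrightarrow> i \<le> D \<Longrightarrow>
      real (c i) * \<tau> (i - 1) + (real k - real (c i)) * \<tau> (i + 1) = \<theta> * \<tau> i"
    using dual_eigenvalue_recurrence by blast
  have \<tau>_ne: "\<tau> i \<noteq> \<tau> j" if "i \<noteq> j" "i \<le> 5" "j \<le> 5" for i j
    using inj_on_dual_eigenvalues that D by (auto simp: inj_on_def)
  \<comment> \<open>Differences of dual eigenvalues are measured in units of
    \<open>\<delta>\<^sub>3\<close>, here \<open>t\<close>. Distinctness of the dual eigenvalues
    makes \<open>t\<close>, \<open>a\<close>, \<open>a + 1\<close> and \<open>1 + b\<close>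
    nonzero.\<close>
  define t where "t = \<tau> 2 - \<tau> 3"
  have "t \<noteq> 0" using \<tau>_ne[of 2 3] by (simp add: t_def)
  define \<rho> where "\<rho> = r 3"
  define a where "a = (\<tau> 1 - \<tau> 2) / t"
  define b where "b = (\<tau> 3 - \<tau> 4) / t"
  define w where "w = a + b"
  define d1 where "d1 = (\<tau> 0 - \<tau> 1) / t"
  define d5 where "d5 = (\<tau> 4 - \<tau> 5) / t"
  define K where "K = real k - 1"
  define c3 where "c3 = real (c 3)"
  define c4 where "c4 = real (c 4)"
  have at: "a * t = \<tau> 1 - \<tau> 2" and bt: "b * t = \<tau> 3 - \<tau> 4"
    and d1t: "d1 * t = \<tau> 0 - \<tau> 1" and d5t: "d5 * t = \<tau> 4 - \<tau> 5"
    using \<open>t \<noteq> 0\<close> by (simp_all add: a_def b_def d1_def d5_def)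
  have "t * a = \<tau> 1 - \<tau> 2" "t * (a + 1) = \<tau> 1 - \<tau> 3" "t * (1 + b) = \<tau> 2 - \<tau> 4"
    using at bt t_def by algebra+
  then have "t * a \<noteq> 0" "t * (a + 1) \<noteq> 0" "t * (1 + b) \<noteq> 0"
    using \<tau>_ne[of 1 2] \<tau>_ne[of 1 3] \<tau>_ne[of 2 4] by simp_all
  then have ab: "a \<noteq> 0" "a + 1 \<noteq> 0" "1 + b \<noteq> 0" by auto

  \<comment> \<open>For diameter 5 such a geodesic identity exists for \<open>i = 0, 1, 2\<close>.
    The middle one expresses \<open>c3\<close> through \<open>\<rho>\<close> and \<open>w\<close>;
    the outer two then determine \<open>d1\<close> and \<open>d5\<close>.\<close>
  have geo: "c3 * (\<tau> (i + 1) - \<tau> (i + 2)) = \<rho> * (\<tau> i - \<tau> (i + 3))" if "i + 3 \<le> 5" for i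
    using balanced_set_condition_geodesic[of r i] r that D by (simp add: c3_def \<rho>_def)
  have geo: "c3 * (\<tau> 1 - \<tau> 2) = \<rho> * (\<tau> 0 - \<tau> 3)" "c3 * (\<tau> 2 - \<tau> 3) = \<rho> * (\<tau> 1 - \<tau> 4)"
    "c3 * (\<tau> 3 - \<tau> 4) = \<rho> * (\<tau> 2 - \<tau> 5)"
    using geo[of 0] geo[of 1] geo[of 2] by (simp_all add: numeral_eq_Suc)
  have "t * c3 = t * (\<rho> * (w + 1))"
    using geo(2) at bt t_def w_def by algebra
  then have c3: "c3 = \<rho> * (w + 1)" using \<open>t \<noteq> 0\<close> by simp
  have "1 \<le> c 3" using c_pos[of 3] D by simp
  then have "c3 \<noteq> 0" "\<rho> \<noteq> 0" using c3 by (auto simp: c3_def)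
  have "c3 * (a * t) = \<rho> * (d1 * t + a * t + t)"
    using geo(1) unfolding at d1t by (simp add: t_def)
  then have "(t * \<rho>) * d1 = (t * \<rho>) * (w * a - 1)" unfolding c3 by algebra
  then have d1: "d1 = w * a - 1" using \<open>t \<noteq> 0\<close> \<open>\<rho> \<noteq> 0\<close> by simp
  have "c3 * (b * t) = \<rho> * (t + b * t + d5 * t)"
    using geo(3) unfolding bt d5t by (simp add: t_def)
  then have "(t * \<rho>) * d5 = (t * \<rho>) * (w * b - 1)" unfolding c3 by algebra
  then have d5: "d5 = w * b - 1" using \<open>t \<noteq> 0\<close> \<open>\<rho> \<noteq> 0\<close> by simp

  have \<theta>1: "\<tau> 0 + K * \<tau> 2 = \<theta> * \<tau> 1"
    using \<theta>[of 1] c_1 D by (simp add: K_def numeral_2_eq_2)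
  have \<theta>2: "\<tau> 1 + K * \<tau> 3 = \<theta> * \<tau> 2"
    using \<theta>[of 2] c2 D by (simp add: K_def)
  have \<theta>3: "c3 * \<tau> 2 + (K + 1 - c3) * \<tau> 4 = \<theta> * \<tau> 3"
    using \<theta>[of 3] D by (simp add: K_def c3_def)
  have \<theta>4: "c4 * \<tau> 3 + (K + 1 - c4) * \<tau> 5 = \<theta> * \<tau> 4"
    using \<theta>[of 4] D by (simp add: K_def c4_def)
  \<comment> \<open>The arbitrary value \<open>\<tau> 6\<close> drops out because its coefficient
    \<open>k - c 5\<close> is 0.\<close>
  have \<theta>5: "(K + 1) * \<tau> 4 = \<theta> * \<tau> 5"
    using \<theta>[of 5] c_diameter D by (simp add: K_def)
  have \<theta>0: "(K + 1) * \<tau> 1 = \<theta> * \<tau> 0"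
    using \<theta>0 by (simp add: K_def)
  note scale = at bt d1t d5t t_def
  \<comment> \<open>The equations \<open>e0\<close> to \<open>e4\<close> arise by subtracting each
    eigenvalue equation from the one before it and dividing by \<open>t\<close>.\<close>
  have "t * (K * a) = t * ((\<theta> + 1) * d1)"
    using \<theta>0 \<theta>1 scale by algebra
  then have e0: "K * a = (\<theta> + 1) * d1" using \<open>t \<noteq> 0\<close> by simp
  have "t * (d1 + K) = t * (\<theta> * a)"
    using \<theta>1 \<theta>2 scale by algebra
  then have e1: "d1 + K = \<theta> * a" using \<open>t \<noteq> 0\<close> by simp
  have "t * (a + (1 - c3) + (K + 1 - c3) * b) = t * \<theta>"
    using \<theta>2 \<theta>3 scale by algebra
  then have e2: "a + (1 - c3) + (K + 1 - c3) * b = \<theta>" using \<open>t \<noteq> 0\<close> by simp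
  have "t * (c3 + (c3 - c4) * b + (K + 1 - c4) * d5) = t * (\<theta> * b)"
    using \<theta>3 \<theta>4 scale by algebra
  then have e3: "c3 + (c3 - c4) * b + (K + 1 - c4) * d5 = \<theta> * b" using \<open>t \<noteq> 0\<close> by simp
  have "t * (c4 * b + (c4 - (K + 1)) * d5) = t * (\<theta> * d5)"
    using \<theta>4 \<theta>5 scale by algebra
  then have e4: "c4 * b + (c4 - (K + 1)) * d5 = \<theta> * d5" using \<open>t \<noteq> 0\<close> by simp
  have curve: "(w\<^sup>2 + 3 * w + 1) * (a\<^sup>2 + 1) = (w ^ 3 + 3 * w\<^sup>2 + 2 * w + 2) * a"
    by (rule dual_ratio_curve[OF ab(1) w_def d1 d5 e0 e1 e2 e3 e4])

  \<comment> \<open>The triple with no counted common neighbour needs two vertices among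
    \<open>c 4\<close> candidates.\<close>
  have "c 4 \<noteq> 1"
  proof
    assume "c 4 = 1"
    then have "c 3 = 1" using c_mono[of 3] \<open>1 \<le> c 3\<close> D by simp
    then have "a + K * b = \<theta>" using e2 by (simp add: c3_def)
    then have "a = -1"
      using k by (intro unit_dual_ratio[OF w_def d1 _ ab(1) e0 e1]) (auto simp: K_def)
    then show False using ab(2) by simp
  qed
  then have "2 \<le> c 4" using c_pos[of 4] D by simp
  obtain x y z where xyz: "d x y = 2" "d y z = 3" "d x z = 3" "card (S 1 y \<inter> S 2 z \<inter> S 1 x) = 0"
    using exists_neighbour_away[OF c2 \<open>2 \<le> c 4\<close>] D by auto
  \<comment> \<open>Here the term with \<open>\<tau> 1 - \<tau> 3\<close> has coefficient 0, for the
    second triple below it has coefficient 1. Comparing the two relations gives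
    \<open>a + 1 = (f0 - f1) * (1 + b)\<close>, with an integral factor.\<close>
  obtain f0 where "real f0 * (\<tau> 2 - \<tau> 4) = \<rho> * t + c3 * t"
    using balanced_set_condition_triangle[OF r xyz(1-3)] xyz(4) unfolding \<rho>_def t_def c3_def by auto
  then have "t * (real f0 * (1 + b)) = t * (\<rho> * (w + 2))"
    using c3 scale by algebra
  then have f0: "real f0 * (1 + b) = \<rho> * (w + 2)" using \<open>t \<noteq> 0\<close> by simp
  obtain x y z where xyz: "d x y = 2" "d y z = 3" "d x z = 3" "card (S 1 y \<inter> S 2 z \<inter> S 1 x) = 1"
    using exists_neighbour_toward[OF c2 k] D by auto
  obtain f1 where "(\<tau> 1 - \<tau> 3) + real f1 * (\<tau> 2 - \<tau> 4) = \<rho> * t + c3 * t"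
    using balanced_set_condition_triangle[OF r xyz(1-3)] xyz(4) unfolding \<rho>_def t_def c3_def by auto
  then have "t * ((a + 1) + real f1 * (1 + b)) = t * (\<rho> * (w + 2))"
    using c3 scale by algebra
  then have f1: "(a + 1) + real f1 * (1 + b) = \<rho> * (w + 2)" using \<open>t \<noteq> 0\<close> by simp
  show False
    by (rule dual_ratio_not_integral[OF ab(2,3) w_def curve, of "int (c 3)" \<rho> "int f0" "int f1"])
      (use c3 \<open>1 \<le> c 3\<close> f0 f1 in \<open>auto simp: c3_def\<close>)
qed

end

theorem theorem6p6:
  fixes E :: "'v::finite rel" and k :: nat
  assumes "distance_regular E"
    and "bipartite E"
    and "Q_polynomial E"
    and "graph_diameter E = 5"
    and "regular_graph E k" and "k \<ge> 3"
  shows "c_number E 2 \<ge> 2 \<and> girth E = 4"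
proof -
  obtain F q where "bij_betw F {..graph_diameter E} {P. primitive_idempotent (bose_mesner E) P}"
    "F 0 = (\<chi> x y. 1 / real CARD('v))" "krein_parameters F (graph_diameter E) q"
    "\<forall>i \<le> graph_diameter E. \<forall>j \<le> graph_diameter E. i \<noteq> j \<longrightarrow> (q 1 i j \<noteq> 0 \<longleftrightarrow> \<bar>int i - int j\<bar> = 1)"
    using assms(3) unfolding Q_polynomial_def Let_def by blast
  then interpret bipartite_Q_polynomial_graph E F q k
    using assms by unfold_locales auto
  have "1 \<le> c 2" "c 2 \<noteq> 1" using c_pos[of 2] c_2_ne_1 assms(4,6) by simp_all
  then have "2 \<le> c 2" by simp
  then show ?thesis using girth_eq_4 assms(4) by simp
qed

end
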